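(* Let $\Bbbk$ be a field of characteristic zero, let $K$ and $K'$ be two Poisson fields over $\Bbbk$ with nontrivial Poisson brackets, and let $n,n'$ be integers. (1) $\mathrm{vht}_n(K)$ is either $-\infty$ or $\ge2$. (2) If $K\subseteq K'$ is a Poisson subfield, then $\mathrm{vht}_n(K)\le\mathrm{vht}_n(K')$. (3) If $n\le n'$, then $\mathrm{vht}_n(K)\ge\mathrm{vht}_{n'}(K)$. (4) If $K$ is of the form $K\{\mathbf f\}$ (with $0\ne\mathbf f\in\Bbbk(x,y)$), then $\mathrm{vht}_n(K)\le\mathrm{vht}_1(K)\le\mathrm{fht}(K)$ for every $n\ge1$.
   Context: For $\mathbf f\in\Bbbk(x,y)$, $K\{\mathbf f\}$ denotes the rational function field $\Bbbk(x,y)$ equipped with the unique ($\Bbbk$-bilinear) Poisson bracket such that $\{x,y\}=\mathbf f$; explicitly $\{g,h\}=\left(\frac{\partial g}{\partial x}\frac{\partial h}{\partial y}-\frac{\partial g}{\partial y}\frac{\partial h}{\partial x}\right)\mathbf f$. Let $K$ be a Poisson field over $\Bbbk$ and $w\in\mathbb Z$. A $w$-valuation on $K$ is a map $\nu:K\to\mathbb Z\cup\{\infty\}$ such that for all $a,b\in K$: $\nu(a)=\infty$ iff $a=0$; $\nu(ab)=\nu(a)+\nu(b)$; $\nu(a+b)\ge\min(\nu(a),\nu(b))$; $\nu(a)=0$ for $a\in\Bbbk^\times$; and $\nu(\{a,b\})\ge\nu(a)+\nu(b)-w$. It is trivial if $\nu(a)=0$ for all $a\neq0$, and classical if $\nu(\{a,b\})>\nu(a)+\nu(b)-w$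 for all nonzero $a,b$. Put $F_0^\nu(K)=\{a\in K\mid\nu(a)\ge0\}$, and for $n\in\mathbb Z$ let ${}^n\Gamma_0(K)=\{a\in K\mid\nu(a)\ge0\text{ for all nontrivial }n\text{-valuations }\nu\text{ on }K\}$ (which is $K$ if there are none). If the bracket on $K$ is nontrivial, the $n$-valuation height is $\mathrm{vht}_n(K)=2+\inf\{w\in\mathbb Z\mid \text{there is a non-classical }w\text{-valuation }\nu\text{ on }K\text{ with }F_0^\nu(K)\cap{}^n\Gamma_0(K)=\Bbbk\}$ (with $\inf\emptyset=+\infty$, and $-\infty$ allowed). For $K$ of the form $K\{\mathbf f\}$, the flag height $\mathrm{fht}(K)$ is the minimum of the total degrees $\deg\mathbf g$ over $\mathbf g\in\Bbbk[x,y]$ with $K\cong K\{\mathbf g\}$ as Poisson fields, and $\infty$ if no such $\mathbf g$ exists. *)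

theory Defs
  imports
    "HOL-Library.Extended_Real"
    "HOL-Computational_Algebra.Polynomial"
    "HOL-Computational_Algebra.Fraction_Field"
begin

section \<open>Poisson fields\<close>

text \<open>
  The underlying field of a Poisson field is a subset of a type of class \<open>field\<close>, so that one
  Poisson field can literally be contained in another. Operations are only constrained on the
  carrier; \<open>scal\<close> is the structure map from the base field into the carrier.
\<close>

record ('k, 'a) poisson =
  carr :: "'a set"
  scal :: "'k \<Rightarrow> 'a"
  pbr :: "'a \<Rightarrow> 'a \<Rightarrow> 'a"

locale poisson_field =
  fixes K :: "('k::field_char_0, 'a::field) poisson"
  assumes add_closed: "a \<in> carr K \<Longrightarrow> b \<in> carr K \<Longrightarrow> a + b \<in> carr K"
    and uminus_closed: "a \<in> carr K \<Longrightarrow> - a \<in> carr K"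
    and mult_closed: "a \<in> carr K \<Longrightarrow> b \<in> carr K \<Longrightarrow> a * b \<in> carr K"
    and inverse_closed: "a \<in> carr K \<Longrightarrow> a \<noteq> 0 \<Longrightarrow> inverse a \<in> carr K"
    and scal_closed: "scal K r \<in> carr K"
    and scal_one: "scal K 1 = 1"
    and scal_add: "scal K (r + s) = scal K r + scal K s"
    and scal_mult: "scal K (r * s) = scal K r * scal K s"
    and br_closed: "a \<in> carr K \<Longrightarrow> b \<in> carr K \<Longrightarrow> pbr K a b \<in> carr K"
    and br_add_left: "a \<in> carr K \<Longrightarrow> a' \<in> carr K \<Longrightarrow> b \<in> carr K \<Longrightarrow>
          pbr K (a + a') b = pbr K a b + pbr K a' b"
    and br_add_right: "a \<in> carr K \<Longrightarrow> b \<in> carr K \<Longrightarrow> b' \<in> carr K \<Longrightarrow>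
          pbr K a (b + b') = pbr K a b + pbr K a b'"
    and br_scal_left: "a \<in> carr K \<Longrightarrow> b \<in> carr K \<Longrightarrow>
          pbr K (scal K r * a) b = scal K r * pbr K a b"
    and br_scal_right: "a \<in> carr K \<Longrightarrow> b \<in> carr K \<Longrightarrow>
          pbr K a (scal K r * b) = scal K r * pbr K a b"
    and br_self: "a \<in> carr K \<Longrightarrow> pbr K a a = 0"
    and jacobi: "a \<in> carr K \<Longrightarrow> b \<in> carr K \<Longrightarrow> c \<in> carr K \<Longrightarrow>
          pbr K a (pbr K b c) + pbr K b (pbr K c a) + pbr K c (pbr K a b) = 0"
    and leibniz: "a \<in> carr K \<Longrightarrow> b \<in> carr K \<Longrightarrow> c \<in> carr K \<Longrightarrow>
          pbr K (a * b) c = a * pbr K b c + pbr K a c * b"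

definition nontrivial_bracket :: "('k, 'a::zero) poisson \<Rightarrow> bool" where
  "nontrivial_bracket K \<longleftrightarrow> (\<exists>a\<in>carr K. \<exists>b\<in>carr K. pbr K a b \<noteq> 0)"

definition poisson_subfield :: "('k, 'a) poisson \<Rightarrow> ('k, 'a) poisson \<Rightarrow> bool" where
  "poisson_subfield K K' \<longleftrightarrow> carr K \<subseteq> carr K' \<and> scal K = scal K' \<and>
     (\<forall>a\<in>carr K. \<forall>b\<in>carr K. pbr K a b = pbr K' a b)"

definition poisson_iso :: "('k, 'a::field) poisson \<Rightarrow> ('k, 'b::field) poisson \<Rightarrow> bool" where
  "poisson_iso K L \<longleftrightarrow> (\<exists>\<phi>. bij_betw \<phi> (carr K) (carr L) \<and>
     (\<forall>a\<in>carr K. \<forall>b\<in>carr K. \<phi> (a + b) = \<phi> a + \<phi> b \<and> \<phi> (a * b) = \<phi> a * \<phi> b \<and>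
        \<phi> (pbr K a b) = pbr L (\<phi> a) (\<phi> b)) \<and>
     (\<forall>c. \<phi> (scal K c) = scal L c))"

section \<open>The Poisson fields $K\{f\}$\<close>

text \<open>
  \<open>k[x,y]\<close> is \<open>k[x][y]\<close>, that is \<open>'k poly poly\<close> with \<open>y\<close> the outer and \<open>x\<close> the inner variable;
  the coefficient of \<open>x^i y^j\<close> in \<open>p\<close> is \<open>coeff (coeff p j) i\<close>.
\<close>

type_synonym 'k ratfun2 = "'k poly poly fract"

definition const2 :: "'k::field_char_0 \<Rightarrow> 'k ratfun2" where
  "const2 c = Fract [:[:c:]:] 1"

definition var_x :: "'k::field_char_0 ratfun2" where
  "var_x = Fract [:[:0, 1:]:] 1"

definition var_y :: "'k::field_char_0 ratfun2" where
  "var_y = Fract [:0, 1:] 1"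

definition pderiv_x :: "'k::field_char_0 poly poly \<Rightarrow> 'k poly poly" where
  "pderiv_x = map_poly pderiv"

definition pderiv_y :: "'k::field_char_0 poly poly \<Rightarrow> 'k poly poly" where
  "pderiv_y = pderiv"

lemma pderiv_x_pCons [simp]: "pderiv_x (pCons a p) = pCons (pderiv a) (pderiv_x p)"
  by (simp add: pderiv_x_def map_poly_pCons)

lemma pderiv_x_0 [simp]: "pderiv_x 0 = 0"
  by (simp add: pderiv_x_def)

lemma pderiv_x_1 [simp]: "pderiv_x 1 = 0"
  by (simp add: pderiv_x_def one_pCons map_poly_pCons)

lemma pderiv_x_add: "pderiv_x (p + q) = pderiv_x p + pderiv_x q"
  by (rule poly_eqI) (simp add: pderiv_x_def coeff_map_poly pderiv_add)

lemma pderiv_x_minus: "pderiv_x (- p) = - pderiv_x p"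
  by (rule poly_eqI) (simp add: pderiv_x_def coeff_map_poly pderiv_minus)

lemma pderiv_x_diff: "pderiv_x (p - q) = pderiv_x p - pderiv_x q"
  by (rule poly_eqI) (simp add: pderiv_x_def coeff_map_poly pderiv_diff)

lemma pderiv_x_smult: "pderiv_x (smult a p) = smult (pderiv a) p + smult a (pderiv_x p)"
  by (rule poly_eqI) (simp add: pderiv_x_def coeff_map_poly pderiv_mult algebra_simps)

lemma pderiv_x_mult: "pderiv_x (p * q) = pderiv_x p * q + p * pderiv_x q"
  by (induction p) (simp_all add: pderiv_x_add pderiv_x_smult algebra_simps)

lemma pderiv_y_mult: "pderiv_y (p * q) = pderiv_y p * q + p * pderiv_y q"
  by (simp add: pderiv_y_def pderiv_mult)

lemma pderiv_y_add: "pderiv_y (p + q) = pderiv_y p + pderiv_y q"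
  by (simp add: pderiv_y_def pderiv_add)

lemma pderiv_y_diff: "pderiv_y (p - q) = pderiv_y p - pderiv_y q"
  by (simp add: pderiv_y_def pderiv_diff)

lemma pderiv_x_y: "pderiv_x (pderiv_y p) = pderiv_y (pderiv_x p)"
  unfolding pderiv_y_def
  by (induction p) (simp_all add: pderiv_pCons pderiv_x_add)

lemma quotient_rule_respects:
  fixes p q r s :: "'a::idom"
  assumes D: "\<And>u v. D (u * v) = D u * v + u * D v"
    and eq: "p * s = r * q"
  shows "(D p * q - p * D q) * (s * s) = (D r * s - r * D s) * (q * q)"
proof -
  have *: "D p * s + p * D s = D r * q + r * D q"
    using eq D by metis
  have "(D p * q - p * D q) * (s * s) - (D r * s - r * D s) * (q * q)
      = q * s * (D p * s + p * D s - (D r * q + r * D q))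
        - (p * s - r * q) * (q * D s + s * D q)"
    by (simp add: algebra_simps)
  then show ?thesis
    using * eq by simp
qed

lift_definition rat_deriv_x :: "'k::field_char_0 ratfun2 \<Rightarrow> 'k ratfun2"
  is "\<lambda>(p, q). (pderiv_x p * q - p * pderiv_x q, q * q)"
  by (clarsimp simp: quotient_rule_respects[OF pderiv_x_mult])

lift_definition rat_deriv_y :: "'k::field_char_0 ratfun2 \<Rightarrow> 'k ratfun2"
  is "\<lambda>(p, q). (pderiv_y p * q - p * pderiv_y q, q * q)"
  by (clarsimp simp: quotient_rule_respects[OF pderiv_y_mult])

lemma rat_deriv_x_Fract:
  "q \<noteq> 0 \<Longrightarrow> rat_deriv_x (Fract p q) = Fract (pderiv_x p * q - p * pderiv_x q) (q * q)"
  by transfer simp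

lemma rat_deriv_y_Fract:
  "q \<noteq> 0 \<Longrightarrow> rat_deriv_y (Fract p q) = Fract (pderiv_y p * q - p * pderiv_y q) (q * q)"
  by transfer simp

definition flag_field :: "'k::field_char_0 ratfun2 \<Rightarrow> ('k, 'k ratfun2) poisson" where
  "flag_field f = \<lparr>carr = UNIV, scal = const2,
     pbr = (\<lambda>g h. (rat_deriv_x g * rat_deriv_y h - rat_deriv_y g * rat_deriv_x h) * f)\<rparr>"

lemma flag_field_bracket_var: "pbr (flag_field f) var_x var_y = f"
  by (simp add: flag_field_def var_x_def var_y_def rat_deriv_x_Fract rat_deriv_y_Fract
      pderiv_y_def pderiv_pCons flip: One_fract_def Zero_fract_def one_pCons)

lemma rat_deriv_x_add: "rat_deriv_x (g + h) = rat_deriv_x g + rat_deriv_x h"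
  by (cases g; cases h)
     (simp add: rat_deriv_x_Fract pderiv_x_add pderiv_x_mult eq_fract, simp add: algebra_simps)

lemma rat_deriv_y_add: "rat_deriv_y (g + h) = rat_deriv_y g + rat_deriv_y h"
  by (cases g; cases h)
     (simp add: rat_deriv_y_Fract pderiv_y_add pderiv_y_mult eq_fract, simp add: algebra_simps)

lemma rat_deriv_x_mult: "rat_deriv_x (g * h) = rat_deriv_x g * h + g * rat_deriv_x h"
  by (cases g; cases h)
     (simp add: rat_deriv_x_Fract pderiv_x_add pderiv_x_mult eq_fract, simp add: algebra_simps)

lemma rat_deriv_y_mult: "rat_deriv_y (g * h) = rat_deriv_y g * h + g * rat_deriv_y h"
  by (cases g; cases h)
     (simp add: rat_deriv_y_Fract pderiv_y_add pderiv_y_mult eq_fract, simp add: algebra_simps)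

lemma rat_deriv_x_y: "rat_deriv_x (rat_deriv_y g) = rat_deriv_y (rat_deriv_x g)"
  by (cases g)
     (simp add: rat_deriv_x_Fract rat_deriv_y_Fract pderiv_x_diff pderiv_y_diff pderiv_x_mult
       pderiv_y_mult pderiv_x_y eq_fract, simp add: algebra_simps)

lemma rat_deriv_x_minus: "rat_deriv_x (- g) = - rat_deriv_x g"
  using rat_deriv_x_add[of "- g" g]
  by (simp add: eq_neg_iff_add_eq_0 rat_deriv_x_Fract Zero_fract_def)

lemma rat_deriv_y_minus: "rat_deriv_y (- g) = - rat_deriv_y g"
  using rat_deriv_y_add[of "- g" g]
  by (simp add: eq_neg_iff_add_eq_0 rat_deriv_y_Fract pderiv_y_def Zero_fract_def)

lemma rat_deriv_x_diff: "rat_deriv_x (g - h) = rat_deriv_x g - rat_deriv_x h"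
  using rat_deriv_x_add[of g "- h"] by (simp add: rat_deriv_x_minus)

lemma rat_deriv_y_diff: "rat_deriv_y (g - h) = rat_deriv_y g - rat_deriv_y h"
  using rat_deriv_y_add[of g "- h"] by (simp add: rat_deriv_y_minus)

lemma rat_deriv_x_const: "rat_deriv_x (const2 c) = 0"
  by (simp add: const2_def rat_deriv_x_Fract flip: Zero_fract_def)

lemma rat_deriv_y_const: "rat_deriv_y (const2 c) = 0"
  by (simp add: const2_def rat_deriv_y_Fract pderiv_y_def pderiv_pCons flip: Zero_fract_def)

lemma poisson_field_flag_field: "poisson_field (flag_field f)"
proof -
  have jac: "(rat_deriv_x a * rat_deriv_y ((rat_deriv_x b * rat_deriv_y c - rat_deriv_y b * rat_deriv_x c) * f)
      - rat_deriv_y a * rat_deriv_x ((rat_deriv_x b * rat_deriv_y c - rat_deriv_y b * rat_deriv_x c) * f)) * f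
    + (rat_deriv_x b * rat_deriv_y ((rat_deriv_x c * rat_deriv_y a - rat_deriv_y c * rat_deriv_x a) * f)
      - rat_deriv_y b * rat_deriv_x ((rat_deriv_x c * rat_deriv_y a - rat_deriv_y c * rat_deriv_x a) * f)) * f
    + (rat_deriv_x c * rat_deriv_y ((rat_deriv_x a * rat_deriv_y b - rat_deriv_y a * rat_deriv_x b) * f)
      - rat_deriv_y c * rat_deriv_x ((rat_deriv_x a * rat_deriv_y b - rat_deriv_y a * rat_deriv_x b) * f)) * f
    = 0" for a b c
    unfolding rat_deriv_x_mult rat_deriv_y_mult rat_deriv_x_diff rat_deriv_y_diff rat_deriv_x_y
    by algebra
  have one: "const2 1 = 1"
    by (simp add: const2_def One_fract_def one_pCons)
  show ?thesis
    by (unfold_locales; (simp only: flag_field_def poisson.simps UNIV_I jac one)?;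
        (simp add: rat_deriv_x_const rat_deriv_y_const rat_deriv_x_add rat_deriv_y_add
          rat_deriv_x_mult rat_deriv_y_mult)?; (simp add: const2_def algebra_simps)?)
qed

section \<open>Valuations\<close>

text \<open>
  A valuation is a function on the ambient type of which only the values on the carrier matter;
  these lie in the integers extended by \<open>\<infinity>\<close>, inside \<open>ereal\<close>.
\<close>

definition w_valuation :: "('k::field_char_0, 'a::field) poisson \<Rightarrow> int \<Rightarrow> ('a \<Rightarrow> ereal) \<Rightarrow> bool" where
  "w_valuation K w \<nu> \<longleftrightarrow>
     (\<forall>a\<in>carr K. \<nu> a = \<infinity> \<or> (\<exists>m::int. \<nu> a = ereal (of_int m))) \<and>
     (\<forall>a\<in>carr K. \<nu> a = \<infinity> \<longleftrightarrow> a = 0) \<and>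
     (\<forall>a\<in>carr K. \<forall>b\<in>carr K. \<nu> (a * b) = \<nu> a + \<nu> b) \<and>
     (\<forall>a\<in>carr K. \<forall>b\<in>carr K. \<nu> (a + b) \<ge> min (\<nu> a) (\<nu> b)) \<and>
     (\<forall>c. c \<noteq> 0 \<longrightarrow> \<nu> (scal K c) = 0) \<and>
     (\<forall>a\<in>carr K. \<forall>b\<in>carr K. \<nu> (pbr K a b) \<ge> \<nu> a + \<nu> b - ereal (of_int w))"

definition trivial_valuation :: "('k, 'a::zero) poisson \<Rightarrow> ('a \<Rightarrow> ereal) \<Rightarrow> bool" where
  "trivial_valuation K \<nu> \<longleftrightarrow> (\<forall>a\<in>carr K. a \<noteq> 0 \<longrightarrow> \<nu> a = 0)"

definition classical_valuation :: "('k, 'a::zero) poisson \<Rightarrow> int \<Rightarrow> ('a \<Rightarrow> ereal) \<Rightarrow> bool" where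
  "classical_valuation K w \<nu> \<longleftrightarrow> (\<forall>a\<in>carr K. \<forall>b\<in>carr K. a \<noteq> 0 \<longrightarrow> b \<noteq> 0 \<longrightarrow>
     \<nu> (pbr K a b) > \<nu> a + \<nu> b - ereal (of_int w))"

definition F0 :: "('a \<Rightarrow> ereal) \<Rightarrow> ('k, 'a) poisson \<Rightarrow> 'a set" where
  "F0 \<nu> K = {a \<in> carr K. \<nu> a \<ge> 0}"

definition Gamma0 :: "int \<Rightarrow> ('k::field_char_0, 'a::field) poisson \<Rightarrow> 'a set" where
  "Gamma0 n K = {a \<in> carr K. \<forall>\<nu>. w_valuation K n \<nu> \<and> \<not> trivial_valuation K \<nu> \<longrightarrow> \<nu> a \<ge> 0}"

section \<open>Valuation height and flag height\<close>

definition vht :: "int \<Rightarrow> ('k::field_char_0, 'a::field) poisson \<Rightarrow> ereal" where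
  "vht n K = 2 + (INF w\<in>{w::int. \<exists>\<nu>. w_valuation K w \<nu> \<and> \<not> classical_valuation K w \<nu> \<and>
                                   F0 \<nu> K \<inter> Gamma0 n K = range (scal K)}. ereal (of_int w))"

text \<open>The supremum in \<open>nat\<close> gives the zero polynomial total degree 0.\<close>

definition total_degree :: "'k::zero poly poly \<Rightarrow> nat" where
  "total_degree p = Sup {i + j | i j. coeff (coeff p j) i \<noteq> 0}"

text \<open>
  As an infimum of a set of natural numbers taken in \<open>ereal\<close>, this is the minimum if the set is
  nonempty and \<open>\<infinity>\<close> otherwise.
\<close>

definition fht :: "('k::field_char_0, 'a::field) poisson \<Rightarrow> ereal" where
  "fht K = (INF g\<in>{g :: 'k poly poly. poisson_iso K (flag_field (Fract g 1))}.
              ereal (of_nat (total_degree g)))"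

end

theory Submission
  imports Defs "Berlekamp_Zassenhaus.Unique_Factorization_Poly"
begin

text \<open>
  Multiplying a valuation by $m \ge 1$ multiplies its weight by $m$, so one negative admissible weight
  makes the height $-\infty$. A valuation pulled back along an embedding $K \to L$ may become classical,
  but as the bracket of $K$ is nontrivial it is non-classical for some smaller weight; hence the
  height is monotone along embeddings, and for the last inequality it suffices to bound the height
  of $K\{g\}$ with $g$ a polynomial. There the negative of the total degree is a non-classical valuation of
  weight $\deg g - 2$, and every $p$-adic valuation with $p$ prime in $k[x, y]$ is a $1$-valuation. An
  element nonnegative for all of these is a polynomial, by unique factorization, of degree $0$.
\<close>

section \<open>Valuations on integral domains and their fraction fields\<close>

text \<open>The value at 0 is left unconstrained, so that \<open>v\<close> can take values in the
  integers; \<open>vge\<close> supplies the convention that 0 has value infinity.\<close>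

locale idom_valuation =
  fixes v :: "'a::idom \<Rightarrow> int"
  assumes v_mult: "p \<noteq> 0 \<Longrightarrow> q \<noteq> 0 \<Longrightarrow> v (p * q) = v p + v q"
    and v_add: "p \<noteq> 0 \<Longrightarrow> q \<noteq> 0 \<Longrightarrow> p + q \<noteq> 0 \<Longrightarrow> min (v p) (v q) \<le> v (p + q)"
begin

definition vge :: "int \<Rightarrow> 'a \<Rightarrow> bool" where
  "vge n p \<longleftrightarrow> p = 0 \<or> n \<le> v p"

lemma vge_add: "vge n p \<Longrightarrow> vge n q \<Longrightarrow> vge n (p + q)"
  unfolding vge_def using v_add[of p q] by (cases "p = 0"; cases "q = 0"; cases "p + q = 0") auto

lemma vge_mult: "vge m p \<Longrightarrow> vge n q \<Longrightarrow> vge (m + n) (p * q)"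
  unfolding vge_def using v_mult[of p q] by (cases "p = 0"; cases "q = 0") auto

lemma v_one: "v 1 = 0"
  using v_mult[of 1 1] by simp

text \<open>Since \<open>- 1\<close> squares to 1, twice its value is
  \<open>v 1 = 0\<close>.\<close>

lemma v_minus: "p \<noteq> 0 \<Longrightarrow> v (- p) = v p"
  using v_mult[of "- 1" "- 1"] v_mult[of "- 1" p] v_one by simp

lemma vge_diff: "vge n p \<Longrightarrow> vge n q \<Longrightarrow> vge n (p - q)"
  using vge_add[of n p "- q"] v_minus[of q] by (cases "q = 0") (simp_all add: vge_def)

lemma vge_self: "vge (v p) p"
  by (simp add: vge_def)

end

text \<open>The extension of \<open>v\<close> to the fraction field. No representative of 0
  qualifies, so the value there is unspecified.\<close>

definition fract_val :: "('a::idom \<Rightarrow> int) \<Rightarrow> 'a fract \<Rightarrow> int" where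
  "fract_val v a = (THE n. \<exists>p q. p \<noteq> 0 \<and> q \<noteq> 0 \<and> a = Fract p q \<and> n = v p - v q)"

lemma fract_nonzero_cases:
  fixes a :: "'a::idom fract"
  assumes "a \<noteq> 0"
  obtains p q where "a = Fract p q" "p \<noteq> 0" "q \<noteq> 0"
  using assms by (cases a rule: Fract_cases_nonzero) auto

context idom_valuation
begin

lemma fract_val_Fract:
  assumes "p \<noteq> 0" "q \<noteq> 0"
  shows "fract_val v (Fract p q) = v p - v q"
  unfolding fract_val_def
proof (rule the_equality)
  show "\<exists>p' q'. p' \<noteq> 0 \<and> q' \<noteq> 0 \<and> Fract p q = Fract p' q' \<and> v p - v q = v p' - v q'"
    using assms by blast
next
  fix n
  assume "\<exists>p' q'. p' \<noteq> 0 \<and> q' \<noteq> 0 \<and> Fract p q = Fract p' q' \<and> n = v p' - v q'"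
  then obtain p' q' where *: "p' \<noteq> 0" "q' \<noteq> 0" "Fract p q = Fract p' q'" "n = v p' - v q'"
    by blast
  then have "p * q' = p' * q"
    using assms by (simp add: eq_fract)
  then have "v p + v q' = v p' + v q"
    using assms * v_mult[of p q'] v_mult[of p' q] by simp
  then show "n = v p - v q"
    using * by simp
qed

lemma fract_val_embed: "p \<noteq> 0 \<Longrightarrow> fract_val v (Fract p 1) = v p"
  by (simp add: fract_val_Fract v_one)

text \<open>Over the common denominator \<open>q * s\<close> the inequality for sums is that of the
  numerators, shifted by \<open>v (q * s)\<close>.\<close>

lemma idom_valuation_fract_val: "idom_valuation (fract_val v)"
proof
  fix a b :: "'a fract"
  assume "a \<noteq> 0" "b \<noteq> 0"
  obtain p q where a: "a = Fract p q" "p \<noteq> 0" "q \<noteq> 0"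
    using \<open>a \<noteq> 0\<close> by (rule fract_nonzero_cases)
  obtain r s where b: "b = Fract r s" "r \<noteq> 0" "s \<noteq> 0"
    using \<open>b \<noteq> 0\<close> by (rule fract_nonzero_cases)
  show "fract_val v (a * b) = fract_val v a + fract_val v b"
    using a b by (simp add: fract_val_Fract v_mult)
  assume "a + b \<noteq> 0"
  have sum: "a + b = Fract (p * s + r * q) (q * s)"
    using a b by simp
  with \<open>a + b \<noteq> 0\<close> have nz: "p * s + r * q \<noteq> 0"
    by (auto simp: fract_collapse)
  have "min (v (p * s)) (v (r * q)) \<le> v (p * s + r * q)"
    using a b nz by (intro v_add) simp_all
  then show "min (fract_val v a) (fract_val v b) \<le> fract_val v (a + b)"
    unfolding sum using a b nz by (simp add: fract_val_Fract v_mult)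
qed

end

text \<open>The quotient rule: if \<open>P = a * Q\<close> then
  \<open>D a * Q = D P - a * D Q\<close>, and both terms on the right have value at least
  \<open>v p + c\<close>; dividing by \<open>Q\<close> subtracts \<open>v q\<close>. A bound on how
  far a derivation lowers values thus need only be checked on the domain.\<close>

lemma vge_derivation_fract:
  fixes D :: "'a::idom fract \<Rightarrow> 'a fract"
  assumes "idom_valuation v"
    and D: "\<And>a b. D (a * b) = a * D b + D a * b"
    and le: "\<And>p. p \<noteq> 0 \<Longrightarrow> idom_valuation.vge (fract_val v) (v p + c) (D (Fract p 1))"
    and "a \<noteq> 0"
  shows "idom_valuation.vge (fract_val v) (fract_val v a + c) (D a)"
proof -
  interpret idom_valuation v by fact
  interpret F: idom_valuation "fract_val v" by (rule idom_valuation_fract_val)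
  obtain p q where a: "a = Fract p q" "p \<noteq> 0" "q \<noteq> 0"
    using \<open>a \<noteq> 0\<close> by (rule fract_nonzero_cases)
  let ?P = "Fract p 1" and ?Q = "Fract q 1"
  have "?P = a * ?Q"
    using a by (simp add: eq_fract)
  then have DP: "D ?P = a * D ?Q + D a * ?Q"
    using D by metis
  have va: "fract_val v a = v p - v q"
    using a by (simp add: fract_val_Fract)
  have "F.vge (fract_val v a + (v q + c)) (a * D ?Q)"
    by (intro F.vge_mult F.vge_self le a)
  then have "F.vge (v p + c) (D ?P - a * D ?Q)"
    using le[OF a(2)] va by (intro F.vge_diff) simp_all
  then have *: "F.vge (v p + c) (D a * ?Q)"
    by (simp add: DP)
  have Q: "?Q \<noteq> 0"
    using a by (simp add: Zero_fract_def eq_fract)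
  show ?thesis
  proof (cases "D a = 0")
    case False
    then have "v p + c \<le> fract_val v (D a) + v q"
      using * Q F.v_mult[of "D a" ?Q] a by (simp add: F.vge_def fract_val_embed)
    then show ?thesis
      by (simp add: F.vge_def va)
  qed (simp add: F.vge_def)
qed

section \<open>From integer-valued functions to w-valuations\<close>

definition ext_val :: "('a::zero \<Rightarrow> int) \<Rightarrow> 'a \<Rightarrow> ereal" where
  "ext_val v a = (if a = 0 then \<infinity> else ereal (of_int (v a)))"

lemma zero_if_double_eq: "x + x = x \<Longrightarrow> x = 0" for x :: "'a::cancel_comm_monoid_add"
  by (metis add_cancel_right_right)

lemma (in poisson_field) zero_closed: "0 \<in> carr K"
  using add_closed[OF scal_closed[of 1] uminus_closed[OF scal_closed[of 1]]] by simp

lemma (in poisson_field) br_zero: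
  assumes "a \<in> carr K"
  shows "pbr K 0 a = 0" "pbr K a 0 = 0"
  using br_add_left[of 0 0 a] br_add_right[of a 0 0] assms zero_closed
  by (auto intro: zero_if_double_eq)

lemma (in poisson_field) scal_zero: "scal K 0 = 0"
  using scal_add[of 0 0] by (intro zero_if_double_eq) simp

text \<open>Brackets with 0 vanish, so the bracket inequality reduces to nonzero arguments, where it
  compares integers.\<close>

lemma w_valuation_ext_val:
  assumes "poisson_field K" and "idom_valuation v"
    and const: "\<And>c. c \<noteq> 0 \<Longrightarrow> v (scal K c) = 0"
    and br: "\<And>a b. a \<in> carr K \<Longrightarrow> b \<in> carr K \<Longrightarrow> a \<noteq> 0 \<Longrightarrow> b \<noteq> 0 \<Longrightarrow>
      idom_valuation.vge v (v a + v b - w) (pbr K a b)"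
  shows "w_valuation K w (ext_val v)"
proof -
  interpret poisson_field K by fact
  interpret idom_valuation v by fact
  have scal0: "scal K c \<noteq> 0" if "c \<noteq> 0" for c
    using scal_mult[of c "inverse c"] scal_one that by auto
  have br': "ext_val v (pbr K a b) \<ge> ext_val v a + ext_val v b - ereal (of_int w)"
    if "a \<in> carr K" "b \<in> carr K" for a b
    using br[OF that] br_zero that by (auto simp: ext_val_def vge_def)
  have add: "ext_val v (a + b) \<ge> min (ext_val v a) (ext_val v b)" for a b
    using v_add[of a b] by (auto simp: ext_val_def min_def)
  show ?thesis
    unfolding w_valuation_def
    by (intro conjI ballI allI impI add br') (auto simp: ext_val_def scal0 const v_mult)
qed

section \<open>Valuations on the Poisson fields $K\{g\}$\<close>

text \<open>The Jacobian determinant, which is the bracket of polynomials normalised by {x, y} =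
  1.\<close>

definition poly_jac :: "'k::field_char_0 poly poly \<Rightarrow> 'k poly poly \<Rightarrow> 'k poly poly" where
  "poly_jac p q = pderiv_x p * pderiv_y q - pderiv_y p * pderiv_x q"

lemma flag_field_bracket_poly:
  "pbr (flag_field (Fract g 1)) (Fract p 1) (Fract q 1) = Fract (poly_jac p q * g) 1"
  by (simp add: flag_field_def poly_jac_def rat_deriv_x_Fract rat_deriv_y_Fract
      pderiv_y_def pderiv_1)

lemma flag_field_simps [simp]:
  "carr (flag_field f) = UNIV" "scal (flag_field f) = const2"
  by (simp_all add: flag_field_def)

text \<open>The bracket is a derivation in each argument, so the reduction from fractions to
  polynomials applies to one argument after the other.\<close>

lemma w_valuation_flag_field:
  fixes v :: "'k::field_char_0 poly poly \<Rightarrow> int"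
  assumes "idom_valuation v"
    and const: "\<And>c. c \<noteq> 0 \<Longrightarrow> v [:[:c:]:] = 0"
    and br: "\<And>p q. p \<noteq> 0 \<Longrightarrow> q \<noteq> 0 \<Longrightarrow> idom_valuation.vge v (v p + v q - w) (poly_jac p q * g)"
  shows "w_valuation (flag_field (Fract g 1)) w (ext_val (fract_val v))"
proof -
  interpret idom_valuation v by fact
  interpret F: idom_valuation "fract_val v" by (rule idom_valuation_fract_val)
  interpret poisson_field "flag_field (Fract g 1)" by (rule poisson_field_flag_field)
  let ?br = "pbr (flag_field (Fract g 1))" and ?v = "fract_val v"
  have embed: "F.vge n (Fract p 1)" if "vge n p" for n p
    using that by (cases "p = 0") (simp_all add: vge_def F.vge_def fract_val_embed fract_collapse)
  have br_mult_right: "?br a (b * c) = b * ?br a c + ?br a b * c" for a b c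
    by (simp add: flag_field_def rat_deriv_x_mult rat_deriv_y_mult algebra_simps)
  \<comment> \<open>First argument: the second one stays a fixed polynomial \<open>q\<close>, and
    the constant of the derivation is \<open>v q - w\<close>.\<close>
  have 1: "F.vge (?v a + (v q - w)) (?br a (Fract q 1))" if "a \<noteq> 0" "q \<noteq> 0" for a q
  proof (rule vge_derivation_fract[where D = "\<lambda>a. ?br a (Fract q 1)"])
    fix p :: "'k poly poly"
    assume "p \<noteq> 0"
    then show "F.vge (v p + (v q - w)) (?br (Fract p 1) (Fract q 1))"
      unfolding flag_field_bracket_poly
      by (intro embed) (use br[of p q] that in \<open>simp add: algebra_simps\<close>)
  qed (use that leibniz in \<open>auto simp: idom_valuation_axioms\<close>)
  \<comment> \<open>Second argument: now \<open>a\<close> is a fixed fraction, the constant is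
    \<open>?v a - w\<close>, and fact \<open>1\<close> is the bound on polynomials.\<close>
  have 2: "F.vge (?v b + (?v a - w)) (?br a b)" if "a \<noteq> 0" "b \<noteq> 0" for a b
    by (rule vge_derivation_fract[where D = "?br a"])
       (use that 1[of a] br_mult_right idom_valuation_axioms in \<open>auto simp: algebra_simps\<close>)
  show ?thesis
  proof (rule w_valuation_ext_val)
    show "idom_valuation ?v" by (rule idom_valuation_fract_val)
    show "?v (scal (flag_field (Fract g 1)) c) = 0" if "c \<noteq> 0" for c
      using that const by (simp add: const2_def fract_val_embed)
    show "F.vge (?v a + ?v b - w) (?br a b)" if "a \<noteq> 0" "b \<noteq> 0" for a b
      using 2[OF that] by (simp add: algebra_simps)
  qed (rule poisson_field_flag_field)
qed

subsection \<open>The total degree\<close>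

text \<open>
  The substitution $p(x, y) \mapsto p(xt, t)$ is an injective ring homomorphism
  $k[x][y] \to k[x][t]$ taking the total degree to the degree in $t$.
\<close>

definition shear_coeff :: "'k::field_char_0 poly \<Rightarrow> 'k poly poly" where
  "shear_coeff c = poly (map_poly (\<lambda>a. [:[:a:]:]) c) [:0, [:0, 1:]:]"

definition shear :: "'k::field_char_0 poly poly \<Rightarrow> 'k poly poly" where
  "shear p = poly (map_poly shear_coeff p) [:0, 1:]"

lemma shear_coeff_0 [simp]: "shear_coeff 0 = 0"
  by (simp add: shear_coeff_def)

lemma shear_coeff_pCons:
  "shear_coeff (pCons a c) = [:[:a:]:] + [:0, [:0, 1:]:] * shear_coeff c"
  by (simp add: shear_coeff_def Polynomial.map_poly_pCons)

lemma shear_0 [simp]: "shear 0 = 0"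
  by (simp add: shear_def)

lemma shear_pCons: "shear (pCons a p) = shear_coeff a + [:0, 1:] * shear p"
  by (simp add: shear_def Polynomial.map_poly_pCons)

lemma coeff_shear_coeff: "coeff (coeff (shear_coeff c) n) i = (if i = n then coeff c n else 0)"
  by (induction c arbitrary: n i)
     (auto simp: shear_coeff_pCons coeff_pCons split: nat.splits)

text \<open>The monomial x^i y^j goes to x^i t^(i+j). The condition \<open>i \<le> n\<close> guards
  the truncated subtraction \<open>n - i\<close>.\<close>

lemma coeff_shear: "coeff (coeff (shear p) n) i = (if i \<le> n then coeff (coeff p (n - i)) i else 0)"
  by (induction p arbitrary: n)
     (auto simp: shear_pCons coeff_shear_coeff coeff_pCons Suc_diff_le split: nat.splits)

lemma shear_eq_0_iff [simp]: "shear p = 0 \<longleftrightarrow> p = 0"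
proof
  assume "shear p = 0"
  then have "coeff (coeff p j) i = 0" for i j
    using coeff_shear[of p "i + j" i] by simp
  then show "p = 0"
    by (intro poly_eqI) simp
qed simp

lemma shear_coeff_add: "shear_coeff (a + b) = shear_coeff a + shear_coeff b"
  by (intro poly_eqI) (simp add: coeff_shear_coeff)

lemma shear_add: "shear (p + q) = shear p + shear q"
  by (intro poly_eqI) (simp add: coeff_shear)

lemma shear_coeff_mult: "shear_coeff (a * b) = shear_coeff a * shear_coeff b"
proof (induction a)
  case (pCons c a)
  have "shear_coeff (smult c b) = [:[:c:]:] * shear_coeff b"
    by (intro poly_eqI) (simp add: coeff_shear_coeff)
  then show ?case
    using pCons by (simp add: shear_coeff_pCons shear_coeff_add algebra_simps)
qed simp

lemma shear_mult: "shear (p * q) = shear p * shear q"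
proof (induction p)
  case (pCons a p)
  have "shear (smult a q) = shear_coeff a * shear q"
    by (induction q) (simp_all add: shear_pCons shear_coeff_mult algebra_simps)
  then show ?case
    using pCons by (simp add: shear_pCons shear_add algebra_simps)
qed simp

lemma le_degree_shear: "coeff (coeff p j) i \<noteq> 0 \<Longrightarrow> i + j \<le> degree (shear p)"
  using coeff_shear[of p "i + j" i] by (intro le_degree) auto

lemma degree_shear_attained:
  assumes "p \<noteq> 0"
  obtains i j where "coeff (coeff p j) i \<noteq> 0" "i + j = degree (shear p)"
proof -
  have "coeff (shear p) (degree (shear p)) \<noteq> 0"
    using assms by simp
  then obtain i where "coeff (coeff (shear p) (degree (shear p))) i \<noteq> 0"
    by (metis leading_coeff_0_iff)
  then have "i \<le> degree (shear p)" "coeff (coeff p (degree (shear p) - i)) i \<noteq> 0"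
    by (auto simp: coeff_shear split: if_splits)
  then show thesis
    using that by simp
qed

text \<open>Distinct monomials have distinct images, so nothing cancels and the degree in t is the
  largest \<open>i + j\<close>. For \<open>p = 0\<close> the supremum of the empty set of naturals
  is 0, which is also \<open>degree 0\<close>.\<close>

lemma total_degree_eq_degree_shear: "total_degree p = degree (shear p)"
proof (cases "p = 0")
  case False
  then obtain i j where "coeff (coeff p j) i \<noteq> 0" "i + j = degree (shear p)"
    by (rule degree_shear_attained)
  then show ?thesis
    unfolding total_degree_def using le_degree_shear[of p]
    by (intro cSup_eq_maximum) (auto, metis)
qed (simp add: total_degree_def)

lemma le_total_degree:
  fixes p :: "'k::field_char_0 poly poly"
  shows "coeff (coeff p j) i \<noteq> 0 \<Longrightarrow> i + j \<le> total_degree p"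
  unfolding total_degree_eq_degree_shear by (rule le_degree_shear)

lemma total_degree_attained:
  fixes p :: "'k::field_char_0 poly poly"
  assumes "p \<noteq> 0"
  obtains i j where "coeff (coeff p j) i \<noteq> 0" "i + j = total_degree p"
  unfolding total_degree_eq_degree_shear using assms by (rule degree_shear_attained)

lemma total_degree_mult:
  fixes p q :: "'k::field_char_0 poly poly"
  shows "p \<noteq> 0 \<Longrightarrow> q \<noteq> 0 \<Longrightarrow> total_degree (p * q) = total_degree p + total_degree q"
  unfolding total_degree_eq_degree_shear shear_mult by (rule degree_mult_eq) simp_all

lemma total_degree_add:
  fixes p q :: "'k::field_char_0 poly poly"
  shows "total_degree (p + q) \<le> max (total_degree p) (total_degree q)"
  unfolding total_degree_eq_degree_shear shear_add by (rule degree_add_le_max)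

text \<open>A monomial of top degree in the derivative comes from one of \<open>p\<close> with the
  exponent of x raised by one.\<close>

lemma total_degree_pderiv_x:
  assumes "pderiv_x p \<noteq> 0"
  shows "total_degree (pderiv_x p) + 1 \<le> total_degree p"
proof -
  obtain i j where ij: "coeff (coeff (pderiv_x p) j) i \<noteq> 0" "i + j = total_degree (pderiv_x p)"
    using assms by (rule total_degree_attained)
  then have "coeff (coeff p j) (Suc i) \<noteq> 0"
    by (auto simp: pderiv_x_def coeff_map_poly coeff_pderiv)
  then show ?thesis
    using le_total_degree[of p j "Suc i"] ij by simp
qed

lemma total_degree_pderiv_y:
  assumes "pderiv_y p \<noteq> 0"
  shows "total_degree (pderiv_y p) + 1 \<le> total_degree p"
proof -
  obtain i j where ij: "coeff (coeff (pderiv_y p) j) i \<noteq> 0" "i + j = total_degree (pderiv_y p)"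
    using assms by (rule total_degree_attained)
  then have "coeff (coeff p (Suc j)) i \<noteq> 0"
    by (auto simp: pderiv_y_def coeff_pderiv of_nat_poly simp del: of_nat_Suc)
  then show ?thesis
    using le_total_degree[of p "Suc j" i] ij by simp
qed

lemma total_degree_eq_0E:
  fixes p :: "'k::field_char_0 poly poly"
  assumes "total_degree p = 0"
  obtains c where "p = [:[:c:]:]"
proof
  have "coeff (coeff p j) i = 0" if "i + j \<noteq> 0" for i j
    using le_total_degree[of p j i] assms that by auto
  then show "p = [:[:coeff (coeff p 0) 0:]:]"
    by (intro poly_eqI) (auto simp: coeff_pCons split: nat.splits)
qed

lemma idom_valuation_total_degree:
  "idom_valuation (\<lambda>p :: 'k::field_char_0 poly poly. - int (total_degree p))"
proof
  fix p q :: "'k poly poly"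
  show "min (- int (total_degree p)) (- int (total_degree q)) \<le> - int (total_degree (p + q))"
    using total_degree_add[of p q] by linarith
qed (simp add: total_degree_mult)

lemma total_degree_const [simp]: "total_degree [:[:c::'k::field_char_0:]:] = 0"
  by (simp add: total_degree_eq_degree_shear shear_pCons shear_coeff_pCons)

lemma total_degree_vars:
  "total_degree [:[:0, 1 :: 'k::field_char_0:]:] = 1"
  "total_degree [:0, 1 :: 'k::field_char_0 poly:] = 1"
proof -
  have "shear_coeff (1 :: 'k poly) = 1"
    by (intro poly_eqI) (auto simp: coeff_shear_coeff)
  moreover have "shear (1 :: 'k poly poly) = 1"
    by (intro poly_eqI) (auto simp: coeff_shear)
  ultimately show "total_degree [:[:0, 1 :: 'k:]:] = 1" "total_degree [:0, 1 :: 'k poly:] = 1"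
    by (simp_all add: total_degree_eq_degree_shear shear_pCons shear_coeff_pCons)
qed

section \<open>The degree valuation on k(x, y)\<close>

definition degree_val :: "'k::field_char_0 ratfun2 \<Rightarrow> ereal" where
  "degree_val = ext_val (fract_val (\<lambda>p. - int (total_degree p)))"

text \<open>Each product in the Jacobian contains two partial derivatives, each of which lowers the
  degree by at least one; this is the 2 in the weight. The factor \<open>g\<close> contributes its
  degree.\<close>

lemma w_valuation_degree_val:
  fixes g :: "'k::field_char_0 poly poly"
  shows "w_valuation (flag_field (Fract g 1)) (int (total_degree g) - 2) degree_val"
  unfolding degree_val_def
proof (rule w_valuation_flag_field[OF idom_valuation_total_degree])
  interpret idom_valuation "\<lambda>p :: 'k poly poly. - int (total_degree p)"
    by (rule idom_valuation_total_degree)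
  let ?d = total_degree
  fix p q :: "'k poly poly"
  have x: "vge (1 - int (?d p)) (pderiv_x p)" for p :: "'k poly poly"
    using total_degree_pderiv_x[of p] by (cases "pderiv_x p = 0") (simp_all add: vge_def)
  have y: "vge (1 - int (?d p)) (pderiv_y p)" for p :: "'k poly poly"
    using total_degree_pderiv_y[of p] by (cases "pderiv_y p = 0") (simp_all add: vge_def)
  have "vge ((1 - int (?d p)) + (1 - int (?d q)) + - int (?d g)) (poly_jac p q * g)"
    unfolding poly_jac_def by (intro vge_mult vge_diff x y vge_self)
  then show "vge (- int (?d p) + - int (?d q) - (int (?d g) - 2)) (poly_jac p q * g)"
    by (simp add: algebra_simps)
qed simp

lemma degree_val_poly: "p \<noteq> 0 \<Longrightarrow> degree_val (Fract p 1) = ereal (- real (total_degree p))"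
  using idom_valuation.fract_val_embed[OF idom_valuation_total_degree, of p]
  by (simp add: degree_val_def ext_val_def Zero_fract_def eq_fract)

lemma degree_val_vars:
  "degree_val (var_x :: 'k::field_char_0 ratfun2) = ereal (- 1)"
  "degree_val (var_y :: 'k::field_char_0 ratfun2) = ereal (- 1)"
  using degree_val_poly[of "[:[:0, 1 :: 'k:]:]"] degree_val_poly[of "[:0, 1 :: 'k poly:]"]
  unfolding total_degree_vars var_x_def var_y_def by simp_all


lemma degree_val_ge_0_iff: "p \<noteq> 0 \<Longrightarrow> degree_val (Fract p 1) \<ge> 0 \<longleftrightarrow> total_degree p = 0"
  by (simp add: degree_val_poly)

subsection \<open>Adic valuations\<close>

text \<open>The multiplicity of \<open>p\<close> in \<open>q\<close>. It is unspecified when there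
  is no such decomposition or no unique exponent, but is always the image of a natural number and
  hence nonnegative.\<close>

definition pval :: "'a::idom \<Rightarrow> 'a \<Rightarrow> int" where
  "pval p q = int (THE n. \<exists>u. q = p ^ n * u \<and> \<not> p dvd u)"

lemma pval_eqI:
  fixes p :: "'a::idom"
  assumes "p \<noteq> 0" "q = p ^ n * u" "\<not> p dvd u"
  shows "pval p q = int n"
proof -
  have "(THE n. \<exists>u. q = p ^ n * u \<and> \<not> p dvd u) = n"
  proof (rule the_equality)
    fix m
    assume "\<exists>u. q = p ^ m * u \<and> \<not> p dvd u"
    then obtain u' where u': "q = p ^ m * u'" "\<not> p dvd u'" by blast
    \<comment> \<open>Cancelling \<open>p ^ i\<close> would leave a factor \<open>p\<close> in
      \<open>s\<close>.\<close>
    have False if "i < j" "p ^ i * s = p ^ j * t" "\<not> p dvd s" for i j s t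
    proof -
      obtain k where "j = i + Suc k"
        using \<open>i < j\<close> less_iff_Suc_add by auto
      with that assms(1) have "s = p * (p ^ k * t)"
        by (simp add: power_add mult.assoc)
      with that show False by simp
    qed
    from this[of n m u u'] this[of m n u' u] show "m = n"
      using assms u' by (metis linorder_neqE_nat)
  qed (use assms in blast)
  then show ?thesis
    by (simp add: pval_def)
qed

text \<open>A nonzero constant is a unit, hence not prime. Cancelling a prime therefore lowers the
  total degree, which makes the inductions below terminate.\<close>

lemma total_degree_pos_if_prime:
  fixes p :: "'k::field_char_0 poly poly"
  assumes "prime_elem p"
  shows "total_degree p > 0"
proof (rule ccontr)
  assume "\<not> total_degree p > 0"
  then obtain c where c: "p = [:[:c:]:]"
    using total_degree_eq_0E by blast
  moreover have "c \<noteq> 0"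
    using c prime_elem_not_zeroI[OF assms] by auto
  ultimately have "p * [:[:inverse c:]:] = 1"
    by (simp flip: one_pCons)
  then have "p dvd 1"
    by (metis dvd_triv_left)
  with prime_elem_not_unit[OF assms] show False ..
qed

lemma prime_power_decomposition:
  fixes p q :: "'k::field_char_0 poly poly"
  assumes "prime_elem p" "q \<noteq> 0"
  obtains n u where "q = p ^ n * u" "\<not> p dvd u"
proof -
  have "\<exists>n u. q = p ^ n * u \<and> \<not> p dvd u"
    using \<open>q \<noteq> 0\<close>
  proof (induction "total_degree q" arbitrary: q rule: less_induct)
    case less
    show ?case
    proof (cases "p dvd q")
      case True
      then obtain q' where q': "q = p * q'" by blast
      with less.prems have "p \<noteq> 0" "q' \<noteq> 0" by auto
      then have "total_degree q' < total_degree q"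
        using total_degree_pos_if_prime[OF assms(1)] by (simp add: q' total_degree_mult)
      then obtain n u where "q' = p ^ n * u" "\<not> p dvd u"
        using less.hyps \<open>q' \<noteq> 0\<close> by blast
      then have "q = p ^ Suc n * u \<and> \<not> p dvd u"
        by (simp add: q')
      then show ?thesis by blast
    next
      case False
      then have "q = p ^ 0 * q \<and> \<not> p dvd q" by simp
      then show ?thesis by blast
    qed
  qed
  then show thesis
    using that by blast
qed

text \<open>Primality of \<open>p\<close> keeps the product of the cofactors prime to
  \<open>p\<close>. For a sum, \<open>p ^ min n m\<close> divides it while \<open>p ^ Suc l\<close>
  does not.\<close>

lemma idom_valuation_pval:
  fixes p :: "'k::field_char_0 poly poly"
  assumes "prime_elem p"
  shows "idom_valuation (pval p)"
proof
  have p: "p \<noteq> 0"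
    using assms by (rule prime_elem_not_zeroI)
  fix q r :: "'k poly poly"
  assume "q \<noteq> 0" "r \<noteq> 0"
  obtain n u where q: "q = p ^ n * u" "\<not> p dvd u"
    using assms \<open>q \<noteq> 0\<close> by (rule prime_power_decomposition)
  obtain m s where r: "r = p ^ m * s" "\<not> p dvd s"
    using assms \<open>r \<noteq> 0\<close> by (rule prime_power_decomposition)
  have vq: "pval p q = int n" and vr: "pval p r = int m"
    using pval_eqI[OF p q] pval_eqI[OF p r] .
  have "\<not> p dvd u * s"
    using prime_elem_dvd_multD[OF assms] q(2) r(2) by blast
  moreover have "q * r = p ^ (n + m) * (u * s)"
    unfolding q(1) r(1) by (simp add: power_add mult_ac)
  ultimately have "pval p (q * r) = int (n + m)"
    by (intro pval_eqI p)
  then show "pval p (q * r) = pval p q + pval p r"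
    by (simp add: vq vr)
  assume "q + r \<noteq> 0"
  obtain l t where sum: "q + r = p ^ l * t" "\<not> p dvd t"
    using assms \<open>q + r \<noteq> 0\<close> by (rule prime_power_decomposition)
  have "p ^ min n m dvd q" "p ^ min n m dvd r"
    unfolding q(1) r(1) by (simp_all add: le_imp_power_dvd dvd_mult2)
  then have "p ^ min n m dvd p ^ l * t"
    unfolding sum(1)[symmetric] by (rule dvd_add)
  moreover have "\<not> p ^ Suc l dvd p ^ l * t"
    using sum(2) p by (simp add: mult.commute[of p])
  ultimately have "min n m \<le> l"
    using power_le_dvd not_less_eq_eq by blast
  then show "min (pval p q) (pval p r) \<le> pval p (q + r)"
    using pval_eqI[OF p sum] by (simp add: vq vr min_def split: if_splits)
qed


lemma pval_self:
  assumes "prime_elem p"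
  shows "pval p p = 1"
  using pval_eqI[of p p 1 1] prime_elem_not_zeroI[OF assms] prime_elem_not_unit[OF assms] by simp

lemma pval_nonneg: "pval p q \<ge> 0"
  by (simp add: pval_def)

lemma le_pval:
  fixes p :: "'k::field_char_0 poly poly"
  assumes "prime_elem p" "q \<noteq> 0" "p ^ n dvd q"
  shows "int n \<le> pval p q"
proof -
  interpret idom_valuation "pval p"
    using assms(1) by (rule idom_valuation_pval)
  obtain r where r: "q = p ^ n * r"
    using assms(3) by (rule dvdE)
  have p: "p \<noteq> 0" "\<not> p dvd 1"
    using prime_elem_not_zeroI[OF assms(1)] prime_elem_not_unit[OF assms(1)] .
  have "pval p (p ^ n) = int n"
    using p by (intro pval_eqI[of p _ n 1]) simp_all
  then have "pval p q = int n + pval p r"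
    using v_mult[of "p ^ n" r] r p assms(2) by auto
  then show ?thesis
    using pval_nonneg[of p r] by simp
qed

section \<open>Brackets of powers and the weight of adic valuations\<close>

lemma poly_jac_mult_left: "poly_jac (a * b) c = a * poly_jac b c + poly_jac a c * b"
  by (simp add: poly_jac_def pderiv_x_mult pderiv_y_mult algebra_simps)

lemma poly_jac_mult_right: "poly_jac a (b * c) = b * poly_jac a c + poly_jac a b * c"
  by (simp add: poly_jac_def pderiv_x_mult pderiv_y_mult algebra_simps)

lemma poly_jac_swap: "poly_jac b a = - poly_jac a b"
  by (simp add: poly_jac_def)

text \<open>The power rule for a derivation, multiplied by \<open>p\<close> so that the exponent
  \<open>n - 1\<close> does not occur.\<close>

lemma poly_jac_power_left: "p * poly_jac (p ^ n) c = of_nat n * p ^ n * poly_jac p c"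
proof (induction n)
  case 0
  then show ?case by (simp add: poly_jac_def pderiv_y_def)
next
  case (Suc n)
  have "p * poly_jac (p ^ Suc n) c = p * (p * poly_jac (p ^ n) c) + p * p ^ n * poly_jac p c"
    by (simp add: poly_jac_mult_left algebra_simps)
  then show ?case
    unfolding Suc by (simp add: algebra_simps)
qed

lemma poly_jac_power_right: "p * poly_jac c (p ^ n) = of_nat n * p ^ n * poly_jac c p"
  using poly_jac_power_left[of p n c] by (simp add: poly_jac_swap[of _ c])

text \<open>By the power rule in both arguments the bracket is a multiple of {p, p} = 0, up to a
  factor \<open>p * p\<close> that cancels.\<close>

lemma poly_jac_powers:
  assumes "p \<noteq> 0"
  shows "poly_jac (p ^ n) (p ^ m) = 0"
proof -
  have "p * (p * poly_jac (p ^ n) (p ^ m)) = of_nat n * p ^ n * (p * poly_jac p (p ^ m))"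
    unfolding poly_jac_power_left by (simp add: ac_simps)
  also have "\<dots> = 0"
    unfolding poly_jac_power_right by (simp add: poly_jac_def)
  finally show ?thesis
    using assms by simp
qed

text \<open>
  A derivation lowers the order at $p$ by at most one, but the bracket, although a derivation in
  each argument, lowers it by at most one in total, as $\{p, p\} = 0$.
\<close>

lemma power_dvd_poly_jac:
  assumes "p \<noteq> 0"
  shows "p ^ (n + m) dvd p * poly_jac (p ^ n * u) (p ^ m * s)"
proof -
  \<comment> \<open>Of the four Leibniz terms, the one with the bracket of the two powers vanishes;
    it is the only one that could lose two factors of \<open>p\<close>.\<close>
  have "poly_jac (p ^ n * u) (p ^ m * s)
      = p ^ n * p ^ m * poly_jac u s + p ^ n * poly_jac u (p ^ m) * s + p ^ m * poly_jac (p ^ n) s * u"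
    by (simp add: poly_jac_mult_left poly_jac_mult_right poly_jac_powers[OF assms] algebra_simps)
  then have "p * poly_jac (p ^ n * u) (p ^ m * s)
      = p ^ n * p ^ m * (p * poly_jac u s)
        + p ^ n * s * (p * poly_jac u (p ^ m)) + p ^ m * u * (p * poly_jac (p ^ n) s)"
    by (simp add: algebra_simps)
  also have "\<dots> = p ^ (n + m) * (p * poly_jac u s + of_nat m * poly_jac u p * s + of_nat n * poly_jac p s * u)"
    unfolding poly_jac_power_left poly_jac_power_right by (simp add: power_add algebra_simps)
  finally show ?thesis
    by simp
qed

text \<open>Multiplication by \<open>p\<close> raises the order by exactly one, and \<open>p\<close>
  times the bracket has order at least \<open>n + m\<close>. The polynomial factor \<open>g\<close>
  cannot lower it.\<close>

lemma w_valuation_pval: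
  fixes p :: "'k::field_char_0 poly poly"
  assumes "prime_elem p"
  shows "w_valuation (flag_field (Fract g 1)) 1 (ext_val (fract_val (pval p)))"
proof (rule w_valuation_flag_field)
  interpret idom_valuation "pval p"
    using assms by (rule idom_valuation_pval)
  show "idom_valuation (pval p)" ..
  have p: "p \<noteq> 0"
    using assms by (rule prime_elem_not_zeroI)
  show "pval p [:[:c:]:] = 0" if "c \<noteq> 0" for c
  proof -
    \<comment> \<open>The values of \<open>c\<close> and of its inverse are both nonnegative and add
      up to 0.\<close>
    have "[:[:c:]:] * [:[:inverse c:]:] = 1"
      using that by (simp flip: one_pCons)
    then have "pval p [:[:c:]:] + pval p [:[:inverse c:]:] = 0"
      using v_mult[of "[:[:c:]:]" "[:[:inverse c:]:]"] that v_one by simp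
    then show ?thesis
      using pval_nonneg[of p "[:[:c:]:]"] pval_nonneg[of p "[:[:inverse c:]:]"] by linarith
  qed
  fix q r :: "'k poly poly"
  assume "q \<noteq> 0" "r \<noteq> 0"
  obtain n u where q: "q = p ^ n * u" "\<not> p dvd u"
    using assms \<open>q \<noteq> 0\<close> by (rule prime_power_decomposition)
  obtain m s where r: "r = p ^ m * s" "\<not> p dvd s"
    using assms \<open>r \<noteq> 0\<close> by (rule prime_power_decomposition)
  have vq: "pval p q = int n" and vr: "pval p r = int m"
    using pval_eqI[OF p q] pval_eqI[OF p r] .
  show "vge (pval p q + pval p r - 1) (poly_jac q r * g)"
  proof (cases "poly_jac q r * g = 0")
    case False
    have "p ^ (n + m) dvd p * poly_jac q r"
      unfolding q(1) r(1) using p by (rule power_dvd_poly_jac)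
    then have "p ^ (n + m) dvd p * (poly_jac q r * g)"
      unfolding mult.assoc[symmetric] by (rule dvd_mult2)
    then have "int (n + m) \<le> pval p (p * (poly_jac q r * g))"
      using assms False p by (intro le_pval) simp_all
    also have "\<dots> = 1 + pval p (poly_jac q r * g)"
      using v_mult[OF p False] pval_self[OF assms] by simp
    finally show ?thesis
      by (simp add: vge_def vq vr)
  qed (simp add: vge_def)
qed

section \<open>Divisibility in k[x, y] from adic values\<close>

lemma prime_divisor_exists_poly:
  fixes q :: "'k::field_char_0 poly poly"
  assumes "q \<noteq> 0" "\<not> q dvd 1"
  obtains p where "prime_elem p" "p dvd q"
proof -
  obtain F where F: "mset_factors F q"
    using mset_factors_exist[OF assms] by blast
  have "F \<noteq> {#}"
    using F by (rule mset_factorsD(2))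
  then obtain p where p: "p \<in># F"
    by (rule multiset_nonemptyE)
  \<comment> \<open>In the factorial ring k[x, y] irreducible elements are prime.\<close>
  have "prime_elem p"
    unfolding prime_elem_iff_irreducible using F p by (rule mset_factorsD(1))
  moreover have "p dvd q"
    unfolding mset_factorsD(3)[OF F, symmetric] using p by (rule dvd_prod_mset)
  ultimately show thesis
    by (rule that)
qed

text \<open>Induction on the total degree of \<open>q\<close>: a prime factor of \<open>q\<close>
  also divides \<open>r\<close> and is cancelled from both, until \<open>q\<close> is a
  unit.\<close>

lemma dvd_if_pval_le:
  fixes q r :: "'k::field_char_0 poly poly"
  assumes "q \<noteq> 0" "r \<noteq> 0" "\<And>p. prime_elem p \<Longrightarrow> pval p q \<le> pval p r"
  shows "q dvd r"
  using assms
proof (induction "total_degree q" arbitrary: q r rule: less_induct)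
  case less
  show ?case
  proof (cases "q dvd 1")
    case True
    then show ?thesis by (rule dvd_trans) simp
  next
    case False
    with less.prems(1) obtain p where p: "prime_elem p" "p dvd q"
      by (rule prime_divisor_exists_poly)
    from p(1) have p0: "p \<noteq> 0" by (rule prime_elem_not_zeroI)
    have "1 \<le> pval p q"
      using le_pval[OF p(1) less.prems(1), of 1] p(2) by simp
    then have "1 \<le> pval p r"
      using less.prems(3)[OF p(1)] by linarith
    then have "p dvd r"
      using pval_eqI[of p r 0 r] p0 by (cases "p dvd r") simp_all
    obtain q' where q': "q = p * q'"
      using p(2) by (rule dvdE)
    obtain r' where r': "r = p * r'"
      using \<open>p dvd r\<close> by (rule dvdE)
    have nz: "q' \<noteq> 0" "r' \<noteq> 0"
      using less.prems(1,2) q' r' by simp_all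
    have "total_degree q' < total_degree q"
      using total_degree_pos_if_prime[OF p(1)] p0 nz by (simp add: q' total_degree_mult)
    \<comment> \<open>Cancelling \<open>p\<close> lowers both values at \<open>P\<close> by the same
      \<open>pval P p\<close>.\<close>
    moreover have "pval P q' \<le> pval P r'" if "prime_elem P" for P
      using less.prems(3)[OF that] idom_valuation.v_mult[OF idom_valuation_pval[OF that]] p0 nz
      by (simp add: q' r')
    ultimately have "q' dvd r'"
      using nz by (intro less.hyps)
    then show ?thesis
      by (simp add: q' r')
  qed
qed

text \<open>Nonnegativity at every adic valuation says that no prime occurs more often in the
  denominator than in the numerator.\<close>

lemma Gamma0_flag_field_subset_polys:
  assumes "a \<in> Gamma0 1 (flag_field (Fract g 1))"
  obtains q where "a = Fract q 1"
proof (cases "a = 0")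
  case True
  then show thesis
    using that[of 0] by (simp add: fract_collapse)
next
  case False
  then obtain r s where rs: "a = Fract r s" "r \<noteq> 0" "s \<noteq> 0"
    by (rule fract_nonzero_cases)
  have "pval p s \<le> pval p r" if p: "prime_elem p" for p
  proof -
    interpret idom_valuation "pval p"
      using p by (rule idom_valuation_pval)
    let ?\<nu> = "ext_val (fract_val (pval p))"
    have "p \<noteq> 0" using p by (rule prime_elem_not_zeroI)
    \<comment> \<open>The prime itself has value 1 and witnesses that its adic valuation is
      nontrivial.\<close>
    then have "Fract p 1 \<noteq> 0" "?\<nu> (Fract p 1) = 1"
      using pval_self[OF p]
      by (simp_all add: ext_val_def fract_val_embed Zero_fract_def eq_fract one_ereal_def)
    then have "\<not> trivial_valuation (flag_field (Fract g 1)) ?\<nu>"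
      by (auto simp: trivial_valuation_def intro!: exI[of _ "Fract p 1"])
    then have "?\<nu> a \<ge> 0"
      using assms w_valuation_pval[OF p] by (auto simp: Gamma0_def)
    then show ?thesis
      using rs False fract_val_Fract[of r s] by (simp add: ext_val_def)
  qed
  then have "s dvd r"
    using rs by (intro dvd_if_pval_le)
  then obtain q where "r = s * q" by blast
  then show thesis
    using that[of q] rs by (simp add: eq_fract)
qed


section \<open>Valuation heights under embeddings and rescaling\<close>

text \<open>Covers both inclusions of Poisson subfields and isomorphisms onto a field K{g}, so one
  monotonicity result serves both.\<close>

definition poisson_embedding ::
    "('a \<Rightarrow> 'b) \<Rightarrow> ('k::field_char_0, 'a::field) poisson \<Rightarrow> ('k, 'b::field) poisson \<Rightarrow> bool" where
  "poisson_embedding \<phi> K L \<longleftrightarrow> (\<forall>a\<in>carr K. \<phi> a \<in> carr L) \<and> inj_on \<phi> (carr K) \<and>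
     (\<forall>a\<in>carr K. \<forall>b\<in>carr K. \<phi> (a + b) = \<phi> a + \<phi> b \<and> \<phi> (a * b) = \<phi> a * \<phi> b \<and>
        \<phi> (pbr K a b) = pbr L (\<phi> a) (\<phi> b)) \<and>
     (\<forall>c. \<phi> (scal K c) = scal L c)"

lemma poisson_embedding_zero_iff:
  assumes "poisson_field K" "poisson_embedding \<phi> K L" "a \<in> carr K"
  shows "\<phi> a = 0 \<longleftrightarrow> a = 0"
proof -
  interpret poisson_field K by fact
  have "\<phi> 0 + \<phi> 0 = \<phi> 0"
    using assms(2) zero_closed unfolding poisson_embedding_def by (metis add_0)
  then have "\<phi> 0 = 0"
    by (rule zero_if_double_eq)
  moreover have "\<phi> a = \<phi> 0 \<longleftrightarrow> a = 0"
    using assms(2,3) zero_closed unfolding poisson_embedding_def by (meson inj_on_eq_iff)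
  ultimately show ?thesis
    by simp
qed

lemma w_valuation_comp:
  assumes "poisson_field K" and e: "poisson_embedding \<phi> K L" and "w_valuation L w \<nu>"
  shows "w_valuation K w (\<nu> \<circ> \<phi>)"
proof -
  have in_L: "\<phi> a \<in> carr L" if "a \<in> carr K" for a
    using e that by (simp add: poisson_embedding_def)
  have \<phi>: "\<phi> (a + b) = \<phi> a + \<phi> b" "\<phi> (a * b) = \<phi> a * \<phi> b" "\<phi> (pbr K a b) = pbr L (\<phi> a) (\<phi> b)"
    if "a \<in> carr K" "b \<in> carr K" for a b
    using e that by (simp_all add: poisson_embedding_def)
  have scal: "\<phi> (scal K c) = scal L c" for c
    using e by (simp add: poisson_embedding_def)
  have "\<forall>a\<in>carr K. \<nu> (\<phi> a) = \<infinity> \<or> (\<exists>m::int. \<nu> (\<phi> a) = ereal (of_int m))"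
    using assms(3) in_L unfolding w_valuation_def by blast
  then show ?thesis
    using assms(3) poisson_embedding_zero_iff[OF assms(1,2)]
    by (auto simp: w_valuation_def in_L \<phi> scal)
qed

section \<open>Changing the weight of a valuation\<close>

lemma w_valuation_bracket:
  "w_valuation K w \<nu> \<Longrightarrow> a \<in> carr K \<Longrightarrow> b \<in> carr K \<Longrightarrow>
    \<nu> a + \<nu> b - ereal (of_int w) \<le> \<nu> (pbr K a b)"
  by (simp add: w_valuation_def)

lemma w_valuation_change_weight:
  assumes "w_valuation K w \<nu>"
    and "\<And>a b. a \<in> carr K \<Longrightarrow> b \<in> carr K \<Longrightarrow> \<nu> a + \<nu> b - ereal (of_int w') \<le> \<nu> (pbr K a b)"
  shows "w_valuation K w' \<nu>"
  by (insert assms(1), unfold w_valuation_def, elim conjE, intro conjI, assumption+, intro ballI)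
     (rule assms(2))

lemma w_valuation_mono:
  assumes "w_valuation K w \<nu>" "w \<le> w'"
  shows "w_valuation K w' \<nu>"
  using assms(1)
proof (rule w_valuation_change_weight)
  fix a b
  assume ab: "a \<in> carr K" "b \<in> carr K"
  have "\<nu> a + \<nu> b - ereal (of_int w') \<le> \<nu> a + \<nu> b - ereal (of_int w)"
    using assms(2) by (intro ereal_minus_mono) simp_all
  also have "\<dots> \<le> \<nu> (pbr K a b)"
    using assms(1) ab by (rule w_valuation_bracket)
  finally show "\<nu> a + \<nu> b - ereal (of_int w') \<le> \<nu> (pbr K a b)" .
qed

lemma w_valuation_value:
  assumes "w_valuation K w \<nu>" "a \<in> carr K" "a \<noteq> 0"
  obtains i :: int where "\<nu> a = ereal (of_int i)"
  using assms unfolding w_valuation_def by blast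

lemma w_valuation_zero: "w_valuation K w \<nu> \<Longrightarrow> poisson_field K \<Longrightarrow> \<nu> 0 = \<infinity>"
  using poisson_field.zero_closed unfolding w_valuation_def by blast

text \<open>Finite values are integers, so a strict inequality leaves room for 1; a vanishing
  bracket has value infinity.\<close>

lemma classical_valuation_lower:
  assumes "poisson_field K" and \<nu>: "w_valuation K w \<nu>" and cl: "classical_valuation K w \<nu>"
  shows "w_valuation K (w - 1) \<nu>"
proof -
  interpret poisson_field K by fact
  have "\<nu> a + \<nu> b - ereal (of_int (w - 1)) \<le> \<nu> (pbr K a b)" if ab: "a \<in> carr K" "b \<in> carr K" for a b
  proof (cases "pbr K a b = 0")
    case True
    then show ?thesis
      using w_valuation_zero[OF \<nu> assms(1)] by simp
  next
    case False
    then have nz: "a \<noteq> 0" "b \<noteq> 0"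
      using br_zero ab by auto
    obtain i where i: "\<nu> a = ereal (of_int i)"
      using \<nu> ab(1) nz(1) by (rule w_valuation_value)
    obtain j where j: "\<nu> b = ereal (of_int j)"
      using \<nu> ab(2) nz(2) by (rule w_valuation_value)
    obtain m where m: "\<nu> (pbr K a b) = ereal (of_int m)"
      using \<nu> br_closed[OF ab] False by (rule w_valuation_value)
    have "\<nu> a + \<nu> b - ereal (of_int w) < \<nu> (pbr K a b)"
      using cl ab nz by (simp add: classical_valuation_def)
    then have "real_of_int (i + j - w) < real_of_int m"
      by (simp add: i j m)
    then have "i + j - (w - 1) \<le> m"
      unfolding of_int_less_iff by simp
    then have "real_of_int (i + j - (w - 1)) \<le> real_of_int m"
      by (rule of_int_le_iff[THEN iffD2])
    then show ?thesis
      by (simp add: i j m)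
  qed
  with \<nu> show ?thesis
    by (rule w_valuation_change_weight)
qed

text \<open>As long as the valuation is classical its weight can be lowered by one. A pair with
  nonzero bracket bounds the possible weights from below by \<open>i + j - m\<close>, so this
  stops.\<close>

lemma nonclassical_weight_exists:
  assumes "poisson_field K" "nontrivial_bracket K" "w_valuation K w \<nu>"
  obtains w' where "w' \<le> w" "w_valuation K w' \<nu>" "\<not> classical_valuation K w' \<nu>"
proof -
  interpret poisson_field K by fact
  obtain a b where ab: "a \<in> carr K" "b \<in> carr K" and "pbr K a b \<noteq> 0"
    using assms(2) by (auto simp: nontrivial_bracket_def)
  then have nz: "a \<noteq> 0" "b \<noteq> 0"
    using br_zero by auto
  obtain i where i: "\<nu> a = ereal (of_int i)"
    using assms(3) ab(1) nz(1) by (rule w_valuation_value)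
  obtain j where j: "\<nu> b = ereal (of_int j)"
    using assms(3) ab(2) nz(2) by (rule w_valuation_value)
  obtain m where m: "\<nu> (pbr K a b) = ereal (of_int m)"
    using assms(3) br_closed[OF ab] \<open>pbr K a b \<noteq> 0\<close> by (rule w_valuation_value)
  have bound: "i + j - m \<le> w" if "w_valuation K w \<nu>" for w
  proof -
    have "real_of_int (i + j - w) \<le> real_of_int m"
      using w_valuation_bracket[OF that ab] by (simp add: i j m)
    then show ?thesis
      unfolding of_int_le_iff by simp
  qed
  have "\<exists>w'\<le>w. w_valuation K w' \<nu> \<and> \<not> classical_valuation K w' \<nu>"
    using assms(3)
  proof (induction "nat (w - (i + j - m))" arbitrary: w rule: less_induct)
    case less
    show ?case
    proof (cases "classical_valuation K w \<nu>")
      case True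
      with less.prems have lower: "w_valuation K (w - 1) \<nu>"
        by (rule classical_valuation_lower[OF assms(1)])
      then have "nat (w - 1 - (i + j - m)) < nat (w - (i + j - m))"
        using bound by fastforce
      then obtain w' where "w' \<le> w - 1" "w_valuation K w' \<nu>" "\<not> classical_valuation K w' \<nu>"
        using less.hyps lower by blast
      then show ?thesis
        by (intro exI[of _ w']) simp
    next
      case False
      with less.prems show ?thesis by blast
    qed
  qed
  then show thesis
    using that by blast
qed

section \<open>Comparison of heights through their admissible weights\<close>

definition height_weights :: "int \<Rightarrow> ('k::field_char_0, 'a::field) poisson \<Rightarrow> int set" where
  "height_weights n K = {w. \<exists>\<nu>. w_valuation K w \<nu> \<and> \<not> classical_valuation K w \<nu> \<and>
     F0 \<nu> K \<inter> Gamma0 n K = range (scal K)}"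

lemma vht_eq: "vht n K = 2 + (INF w\<in>height_weights n K. ereal (of_int w))"
  by (simp add: vht_def height_weights_def)

lemma vht_le_if_dominated:
  assumes "\<And>w. w \<in> height_weights n' L \<Longrightarrow> \<exists>w'\<in>height_weights n K. w' \<le> w"
  shows "vht n K \<le> vht n' L"
  unfolding vht_eq
proof (intro add_left_mono INF_mono)
  fix w
  assume "w \<in> height_weights n' L"
  then show "\<exists>w'\<in>height_weights n K. ereal (of_int w') \<le> ereal (of_int w)"
    using assms by fastforce
qed

lemma scal_nonneg:
  assumes "poisson_field K" "w_valuation K w \<nu>"
  shows "\<nu> (scal K c) \<ge> 0"
proof (cases "c = 0")
  case True
  then show ?thesis
    using w_valuation_zero[OF assms(2,1)] poisson_field.scal_zero[OF assms(1)] by simp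
next
  case False
  then have "\<nu> (scal K c) = 0"
    using assms(2) unfolding w_valuation_def by blast
  then show ?thesis by simp
qed

text \<open>The half of the condition on scalars that always holds; each later construction has only
  the reverse inclusion to check.\<close>

lemma scal_subset_F0_Gamma0:
  assumes "poisson_field K" "w_valuation K w \<nu>"
  shows "range (scal K) \<subseteq> F0 \<nu> K \<inter> Gamma0 n K"
  using poisson_field.scal_closed[OF assms(1)] scal_nonneg[OF assms(1)] assms(2)
  by (auto simp: F0_def Gamma0_def)

text \<open>An n-valuation of \<open>L\<close> pulls back to an n-valuation of \<open>K\<close>. If
  the pullback is nontrivial, the hypothesis on \<open>a\<close> applies; if it is trivial, its
  value at \<open>a\<close> is 0 or infinity.\<close>

lemma Gamma0_embedding:
  assumes "poisson_field K" and e: "poisson_embedding \<phi> K L" and a: "a \<in> Gamma0 n K"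
  shows "\<phi> a \<in> Gamma0 n L"
proof -
  have aK: "a \<in> carr K"
    using a by (simp add: Gamma0_def)
  have "\<mu> (\<phi> a) \<ge> 0" if \<mu>: "w_valuation L n \<mu>" for \<mu>
  proof (cases "trivial_valuation K (\<mu> \<circ> \<phi>)")
    case True
    then have "a = 0 \<or> \<mu> (\<phi> a) = 0"
      using aK by (auto simp: trivial_valuation_def)
    moreover have "(\<mu> \<circ> \<phi>) 0 = \<infinity>"
      using w_valuation_zero[OF w_valuation_comp[OF assms(1) e \<mu>] assms(1)] .
    ultimately show ?thesis by auto
  next
    case False
    then show ?thesis
      using a w_valuation_comp[OF assms(1) e \<mu>] by (auto simp: Gamma0_def)
  qed
  then show ?thesis
    using e aK by (simp add: Gamma0_def poisson_embedding_def)
qed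

text \<open>An element satisfying both conditions for the pulled-back valuation has its image in the
  same intersection for \<open>L\<close>, so the image is a scalar and, by injectivity, so is the
  element.\<close>

lemma vht_embedding_mono:
  assumes "poisson_field K" "nontrivial_bracket K" and e: "poisson_embedding \<phi> K L"
  shows "vht n K \<le> vht n L"
proof (rule vht_le_if_dominated)
  fix w
  assume "w \<in> height_weights n L"
  then obtain \<nu> where \<nu>: "w_valuation L w \<nu>" "F0 \<nu> L \<inter> Gamma0 n L = range (scal L)"
    by (auto simp: height_weights_def)
  note comp = w_valuation_comp[OF assms(1) e \<nu>(1)]
  obtain w' where w': "w' \<le> w" "w_valuation K w' (\<nu> \<circ> \<phi>)" "\<not> classical_valuation K w' (\<nu> \<circ> \<phi>)"
    using assms(1,2) comp by (rule nonclassical_weight_exists)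
  have "a \<in> range (scal K)" if a: "a \<in> F0 (\<nu> \<circ> \<phi>) K" "a \<in> Gamma0 n K" for a
  proof -
    have aK: "a \<in> carr K"
      using a by (simp add: F0_def)
    have "\<phi> a \<in> F0 \<nu> L"
      using a e by (simp add: F0_def poisson_embedding_def)
    then obtain c where "\<phi> a = scal L c"
      using Gamma0_embedding[OF assms(1) e a(2)] \<nu>(2) by blast
    then have "\<phi> a = \<phi> (scal K c)"
      using e by (simp add: poisson_embedding_def)
    then have "a = scal K c"
      using e aK poisson_field.scal_closed[OF assms(1)] unfolding poisson_embedding_def
      by (meson inj_on_eq_iff)
    then show ?thesis by blast
  qed
  then have "F0 (\<nu> \<circ> \<phi>) K \<inter> Gamma0 n K = range (scal K)"
    using scal_subset_F0_Gamma0[OF assms(1) comp] by blast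
  then show "\<exists>w'\<in>height_weights n K. w' \<le> w"
    using w' by (auto simp: height_weights_def)
qed

text \<open>Every n-valuation is an n'-valuation, so \<open>Gamma0\<close> shrinks as n grows, while
  the same valuation keeps its weight.\<close>

lemma vht_antimono:
  assumes "poisson_field K" "n \<le> n'"
  shows "vht n' K \<le> vht n K"
proof (rule vht_le_if_dominated)
  fix w
  assume "w \<in> height_weights n K"
  then obtain \<nu> where \<nu>: "w_valuation K w \<nu>" "\<not> classical_valuation K w \<nu>"
    "F0 \<nu> K \<inter> Gamma0 n K = range (scal K)"
    by (auto simp: height_weights_def)
  have "Gamma0 n' K \<subseteq> Gamma0 n K"
    using w_valuation_mono[OF _ assms(2)] by (auto simp: Gamma0_def)
  then have "F0 \<nu> K \<inter> Gamma0 n' K = range (scal K)"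
    using scal_subset_F0_Gamma0[OF assms(1) \<nu>(1)] \<nu>(3) by blast
  then show "\<exists>w'\<in>height_weights n' K. w' \<le> w"
    using \<nu> by (auto simp: height_weights_def)
qed

section \<open>Rescaling and the dichotomy\<close>

lemma height_weights_scale:
  fixes m :: nat
  assumes "poisson_field K" "w \<in> height_weights n K" "m > 0"
  shows "int m * w \<in> height_weights n K"
proof -
  interpret poisson_field K by fact
  obtain \<nu> where \<nu>: "w_valuation K w \<nu>" "\<not> classical_valuation K w \<nu>"
    "F0 \<nu> K \<inter> Gamma0 n K = range (scal K)"
    using assms(2) by (auto simp: height_weights_def)
  define \<mu> where "\<mu> a = ereal (real m) * \<nu> a" for a
  note zero = w_valuation_zero[OF \<nu>(1) assms(1)]
  \<comment> \<open>In \<open>ereal\<close> the product of 0 and infinity is 0, so positivity of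
    \<open>m\<close> matters here.\<close>
  have \<mu>_zero: "\<mu> 0 = \<infinity>"
    using zero assms(3) by (simp add: \<mu>_def)
  have \<mu>_val: "\<mu> a = ereal (of_int (int m * i))" if "\<nu> a = ereal (of_int i)" for a i
    using that by (simp add: \<mu>_def)
  \<comment> \<open>The second conjunct records that scaling preserves strictness in both
    directions, which carries over non-classicality.\<close>
  have br: "(\<mu> a + \<mu> b - ereal (of_int (int m * w)) \<le> \<mu> (pbr K a b)) \<and>
      (a \<noteq> 0 \<longrightarrow> b \<noteq> 0 \<longrightarrow> (\<mu> a + \<mu> b - ereal (of_int (int m * w)) < \<mu> (pbr K a b) \<longleftrightarrow>
         \<nu> a + \<nu> b - ereal (of_int w) < \<nu> (pbr K a b)))"
    if ab: "a \<in> carr K" "b \<in> carr K" for a b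
  proof (cases "a = 0 \<or> b = 0")
    case True
    then show ?thesis
      using br_zero ab \<mu>_zero by auto
  next
    case False
    obtain i where i: "\<nu> a = ereal (of_int i)"
      using \<nu>(1) ab(1) False by (auto elim: w_valuation_value)
    obtain j where j: "\<nu> b = ereal (of_int j)"
      using \<nu>(1) ab(2) False by (auto elim: w_valuation_value)
    show ?thesis
    proof (cases "pbr K a b = 0")
      case True
      then show ?thesis
        by (simp add: zero \<mu>_zero \<mu>_val[OF i] \<mu>_val[OF j] i j)
    next
      case False
      obtain k where k: "\<nu> (pbr K a b) = ereal (of_int k)"
        using \<nu>(1) br_closed[OF ab] False by (rule w_valuation_value)
      have eq: "int m * i + int m * j - int m * w = int m * (i + j - w)"
        by (simp add: algebra_simps)
      have "real_of_int (i + j - w) \<le> real_of_int k"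
        using w_valuation_bracket[OF \<nu>(1) ab] by (simp add: i j k)
      then have "i + j - w \<le> k"
        by (simp only: of_int_le_iff)
      then have "real_of_int (int m * i + int m * j - int m * w) \<le> real_of_int (int m * k)"
        unfolding of_int_le_iff eq by (intro mult_left_mono) simp_all
      moreover have "real_of_int (int m * i + int m * j - int m * w) < real_of_int (int m * k) \<longleftrightarrow>
          real_of_int (i + j - w) < real_of_int k"
        unfolding of_int_less_iff eq using assms(3) by simp
      ultimately show ?thesis
        unfolding \<mu>_val[OF i] \<mu>_val[OF j] \<mu>_val[OF k] i j k by simp
    qed
  qed
  have "w_valuation K (int m * w) \<mu>"
  proof -
    have fin: "(\<mu> a = \<infinity> \<or> (\<exists>i::int. \<mu> a = ereal (of_int i))) \<and> (\<mu> a = \<infinity> \<longleftrightarrow> a = 0)"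
      if "a \<in> carr K" for a
    proof (cases "a = 0")
      case False
      obtain i where "\<nu> a = ereal (of_int i)"
        using \<nu>(1) \<open>a \<in> carr K\<close> False by (rule w_valuation_value)
      then show ?thesis
        using \<mu>_val False by (metis PInfty_neq_ereal(1))
    qed (simp add: \<mu>_zero)
    have mult: "\<mu> (a * b) = \<mu> a + \<mu> b" if "a \<in> carr K" "b \<in> carr K" for a b
      using \<nu>(1) that by (simp add: w_valuation_def \<mu>_def mult.commute[of "ereal (real m)"] distrib_left_ereal_nn)
    have add: "min (\<mu> a) (\<mu> b) \<le> \<mu> (a + b)" if "a \<in> carr K" "b \<in> carr K" for a b
    proof -
      have "min (\<nu> a) (\<nu> b) \<le> \<nu> (a + b)"
        using \<nu>(1) that by (simp add: w_valuation_def)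
      then have "\<mu> a \<le> \<mu> (a + b) \<or> \<mu> b \<le> \<mu> (a + b)"
        unfolding \<mu>_def by (auto simp: min_le_iff_disj intro: ereal_mult_left_mono)
      then show ?thesis
        by (simp add: min_le_iff_disj)
    qed
    have "\<mu> (scal K c) = 0" if "c \<noteq> 0" for c
      using \<nu>(1) that by (simp add: w_valuation_def \<mu>_def)
    then show ?thesis
      unfolding w_valuation_def
      by (intro conjI ballI allI impI fin[THEN conjunct1] fin[THEN conjunct2] mult add
          br[THEN conjunct1])
  qed
  moreover have "\<not> classical_valuation K (int m * w) \<mu>"
    using \<nu>(2) br unfolding classical_valuation_def by blast
  moreover have "F0 \<mu> K = F0 \<nu> K"
    using assms(3) by (auto simp: F0_def \<mu>_def ereal_zero_le_0_iff)
  ultimately show ?thesis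
    using \<nu>(3) by (auto simp: height_weights_def)
qed

lemma vht_dichotomy:
  assumes "poisson_field K"
  shows "vht n K = -\<infinity> \<or> vht n K \<ge> 2"
proof (cases "\<forall>w\<in>height_weights n K. w \<ge> 0")
  case True
  then have "0 \<le> (INF w\<in>height_weights n K. ereal (of_int w))"
    by (intro INF_greatest) simp
  then show ?thesis
    unfolding vht_eq by (metis add.right_neutral add_left_mono)
next
  case False
  then obtain w where w: "w \<in> height_weights n K" "w < 0"
    by auto
  have "(INF w\<in>height_weights n K. ereal (of_int w)) = -\<infinity>"
  proof (rule ereal_bot)
    fix B :: real
    \<comment> \<open>Since \<open>w \<le> - 1\<close>, the multiple \<open>m * w\<close> is at most
      \<open>- m\<close>, and \<open>m\<close> exceeds the absolute value of \<open>B\<close>;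
      \<open>Suc\<close> keeps \<open>m\<close> positive.\<close>
    define m where "m = Suc (nat \<lceil>\<bar>B\<bar>\<rceil>)"
    have "int m * w \<le> int m * - 1"
      using w(2) by (intro mult_left_mono) simp_all
    then have "real_of_int (int m * w) \<le> real_of_int (int m * - 1)"
      by (simp only: of_int_le_iff)
    also have "\<dots> \<le> B"
      unfolding m_def by simp linarith
    finally have "ereal (of_int (int m * w)) \<le> ereal B"
      by simp
    moreover have "int m * w \<in> height_weights n K"
      using assms w(1) by (rule height_weights_scale) (simp add: m_def)
    ultimately show "(INF w\<in>height_weights n K. ereal (of_int w)) \<le> ereal B"
      by (rule INF_lower2[rotated])
  qed
  then show ?thesis
    by (simp add: vht_eq)
qed

section \<open>Comparison with the flag height\<close>

lemma vht_flag_field_le: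
  fixes g :: "'k::field_char_0 poly poly"
  assumes "g \<noteq> 0"
  shows "vht 1 (flag_field (Fract g 1)) \<le> ereal (of_nat (total_degree g))"
proof -
  let ?K = "flag_field (Fract g 1)"
  have "\<not> classical_valuation ?K (int (total_degree g) - 2) degree_val"
  proof
    assume "classical_valuation ?K (int (total_degree g) - 2) degree_val"
    moreover have "(var_x :: 'k ratfun2) \<noteq> 0" "(var_y :: 'k ratfun2) \<noteq> 0"
      by (simp_all add: var_x_def var_y_def Zero_fract_def eq_fract)
    \<comment> \<open>For x and y the bracket bound is an equality: both sides are minus the degree
      of \<open>g\<close>, as - 1 - 1 - (deg g - 2) = - deg g.\<close>
    ultimately have "degree_val (var_x :: 'k ratfun2) + degree_val (var_y :: 'k ratfun2)
        - ereal (of_int (int (total_degree g) - 2)) < degree_val (pbr ?K var_x var_y)"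
      by (simp add: classical_valuation_def)
    then show False
      using assms by (simp add: flag_field_bracket_var degree_val_vars degree_val_poly)
  qed
  moreover have "a \<in> range const2" if "a \<in> F0 degree_val ?K" "a \<in> Gamma0 1 ?K" for a
  proof -
    obtain q where q: "a = Fract q 1"
      using \<open>a \<in> Gamma0 1 ?K\<close> by (rule Gamma0_flag_field_subset_polys)
    \<comment> \<open>The case \<open>q = 0\<close> is included, because the zero polynomial has
      total degree 0 here.\<close>
    have "total_degree q = 0"
      using that(1) q by (cases "q = 0") (simp_all add: F0_def degree_val_ge_0_iff total_degree_eq_degree_shear)
    then obtain c where "q = [:[:c:]:]"
      by (rule total_degree_eq_0E)
    then show ?thesis
      using q by (simp add: const2_def)
  qed
  then have "F0 degree_val ?K \<inter> Gamma0 1 ?K = range (scal ?K)"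
    using scal_subset_F0_Gamma0[OF poisson_field_flag_field w_valuation_degree_val, of g 1] by auto
  ultimately have "int (total_degree g) - 2 \<in> height_weights 1 ?K"
    using w_valuation_degree_val[of g] by (auto simp: height_weights_def)
  then have "(INF w\<in>height_weights 1 ?K. ereal (of_int w)) \<le> ereal (of_int (int (total_degree g) - 2))"
    by (rule INF_lower)
  then have "vht 1 ?K \<le> 2 + ereal (of_int (int (total_degree g) - 2))"
    unfolding vht_eq by (rule add_left_mono)
  also have "\<dots> = ereal (of_nat (total_degree g))"
    using plus_ereal.simps(1)[of 2 "of_int (int (total_degree g) - 2)"] by simp
  finally show ?thesis .
qed

lemma poisson_iso_imp_embedding:
  assumes "poisson_iso K L"
  obtains \<phi> where "poisson_embedding \<phi> K L"
proof -
  obtain \<phi> where \<phi>: "bij_betw \<phi> (carr K) (carr L)"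
      "\<forall>a\<in>carr K. \<forall>b\<in>carr K. \<phi> (a + b) = \<phi> a + \<phi> b \<and> \<phi> (a * b) = \<phi> a * \<phi> b \<and>
         \<phi> (pbr K a b) = pbr L (\<phi> a) (\<phi> b)"
      "\<forall>c. \<phi> (scal K c) = scal L c"
    using assms unfolding poisson_iso_def by (elim exE conjE)
  then have "poisson_embedding \<phi> K L"
    unfolding poisson_embedding_def using bij_betwE[OF \<phi>(1)] bij_betw_imp_inj_on[OF \<phi>(1)] by simp
  then show thesis
    by (rule that)
qed

lemma vht_1_le_fht:
  fixes K :: "('k::field_char_0, 'a::field) poisson"
  assumes "poisson_field K" "nontrivial_bracket K"
  shows "vht 1 K \<le> fht K"
  unfolding fht_def
proof (rule INF_greatest)
  fix g :: "'k poly poly"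
  assume "g \<in> {g. poisson_iso K (flag_field (Fract g 1))}"
  then obtain \<phi> where \<phi>: "poisson_embedding \<phi> K (flag_field (Fract g 1))"
    using poisson_iso_imp_embedding by blast
  \<comment> \<open>The bracket of K{0} vanishes, whereas an embedding keeps a nonzero bracket of
    \<open>K\<close> nonzero.\<close>
  have "g \<noteq> 0"
  proof
    assume "g = 0"
    obtain a b where ab: "a \<in> carr K" "b \<in> carr K" "pbr K a b \<noteq> 0"
      using assms(2) by (auto simp: nontrivial_bracket_def)
    have "\<phi> (pbr K a b) = 0"
      using \<phi> ab \<open>g = 0\<close> by (simp add: poisson_embedding_def) (simp add: flag_field_def fract_collapse)
    then show False
      using poisson_embedding_zero_iff[OF assms(1) \<phi>] poisson_field.br_closed[OF assms(1)] ab by blast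
  qed
  then show "vht 1 K \<le> ereal (of_nat (total_degree g))"
    using vht_embedding_mono[OF assms \<phi>] vht_flag_field_le order_trans by blast
qed

theorem lemma3p14:
  fixes K K' :: "('k::field_char_0, 'a::field) poisson" and n n' :: int
  assumes "poisson_field K" and "poisson_field K'"
    and "nontrivial_bracket K" and "nontrivial_bracket K'"
  shows "(vht n K = -\<infinity> \<or> vht n K \<ge> 2) \<and>
    (poisson_subfield K K' \<longrightarrow> vht n K \<le> vht n K') \<and>
    (n \<le> n' \<longrightarrow> vht n K \<ge> vht n' K) \<and>
    ((\<exists>f :: 'k ratfun2. f \<noteq> 0 \<and> poisson_iso K (flag_field f)) \<longrightarrow>
       (\<forall>m::int. m \<ge> 1 \<longrightarrow> vht m K \<le> vht 1 K \<and> vht 1 K \<le> fht K))"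
proof -
  have "poisson_subfield K K' \<Longrightarrow> poisson_embedding id K K'"
    by (auto simp: poisson_subfield_def poisson_embedding_def)
  \<comment> \<open>Monotonicity along \<open>id\<close> gives the claim on subfields; the first
    inequality of the last claim is antitonicity in the index, from 1 to \<open>m\<close>.\<close>
  then show ?thesis
    using vht_dichotomy[OF assms(1)] vht_embedding_mono[OF assms(1,3)] vht_antimono[OF assms(1)]
      vht_1_le_fht[OF assms(1,3)] by blast
qed

end
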